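(* Let $A\in\mathbb{Z}^{m\times n}$, $l,u\in\mathbb{Z}^n$ with $l\le\mathbf{0}\le u$, let $f:\mathbb{R}^n\to\mathbb{R}$ be separable convex, and let $s\in\mathbb{Z}_{\ge1}$. Consider $$\min\{f(x)\mid Ax=\mathbf{0},\ l\le x\le u,\ x\in\mathbb{Z}^n\}\quad(1)\qquad\text{and}\qquad\min\{f(x)\mid Ax=\mathbf{0},\ l\le x\le u,\ x\in s\mathbb{Z}^n\}\quad(2).$$ For every optimal solution $z^*$ of (1) there exists an optimal solution $\hat z$ of (2) such that $$\|z^*-\hat z\|_1\le(s+1)\,n\,g_1(A),$$ and for every optimal solution $z^*$ of (1) there exists an optimal solution $\hat z$ of (2) such that $$\|z^*-\hat z\|_\infty\le(s+1)\,n\,g_\infty(A),$$ and both bounds can be achieved by the same $\hat z$. Vice versa, for every optimal solution $\hat z$ of (2) there exists an optimal solution $z^*$ of (1) within the same distances.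
   Context: $f$ is separable convex if $f(x)=\sum_{i=1}^n f_i(x_i)$ with each $f_i$ convex. $s\mathbb{Z}^n:=\{sx\mid x\in\mathbb{Z}^n\}$. For $x,y\in\mathbb{R}^n$ write $x\sqsubseteq y$ if $x_iy_i\ge0$ and $|x_i|\le|y_i|$ for all $i$. The Graver basis $\mathcal{G}(A)$ is the (finite) set of $\sqsubseteq$-minimal elements of $\{x\in\mathbb{Z}^n\mid Ax=\mathbf{0}\}\setminus\{\mathbf{0}\}$; $g_\infty(A):=\max_{g\in\mathcal{G}(A)}\|g\|_\infty$ and $g_1(A):=\max_{g\in\mathcal{G}(A)}\|g\|_1$ (interpreted as $0$ if $\mathcal{G}(A)=\emptyset$). *)

theory Defs
  imports "HOL-Analysis.Analysis"
begin

definition real_vec :: "int ^ 'n \<Rightarrow> real ^ 'n" where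
  "real_vec x = (\<chi> i. of_int (x $ i))"

definition norm1 :: "real ^ 'n \<Rightarrow> real" where
  "norm1 x = (\<Sum>i\<in>UNIV. \<bar>x $ i\<bar>)"

definition separable_convex :: "(real ^ 'n \<Rightarrow> real) \<Rightarrow> bool" where
  "separable_convex f \<longleftrightarrow>
     (\<exists>F :: 'n \<Rightarrow> real \<Rightarrow> real.
        (\<forall>i. convex_on UNIV (F i)) \<and> (\<forall>x. f x = (\<Sum>i\<in>UNIV. F i (x $ i))))"

definition scaled_lattice :: "int \<Rightarrow> (int ^ 'n) set" where
  "scaled_lattice s = range (\<lambda>x. s *s x)"

definition conformal :: "real ^ 'n \<Rightarrow> real ^ 'n \<Rightarrow> bool"  (infix \<open>\<sqsubseteq>\<^sub>c\<close> 50) where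
  "x \<sqsubseteq>\<^sub>c y \<longleftrightarrow> (\<forall>i. x $ i * y $ i \<ge> 0 \<and> \<bar>x $ i\<bar> \<le> \<bar>y $ i\<bar>)"

definition graver_basis :: "int ^ 'n ^ 'm \<Rightarrow> (int ^ 'n) set" where
  "graver_basis A =
     (let K = {x. A *v x = 0} - {0}
      in {g \<in> K. \<forall>h\<in>K. real_vec h \<sqsubseteq>\<^sub>c real_vec g \<longrightarrow> h = g})"

text \<open>The Graver basis is finite, so \<^const>\<open>Max\<close> is the actual maximum here.\<close>

definition g_inf :: "int ^ 'n ^ 'm \<Rightarrow> real" where
  "g_inf A = (if graver_basis A = {} then 0
              else Max ((\<lambda>g. infnorm (real_vec g)) ` graver_basis A))"

definition g_one :: "int ^ 'n ^ 'm \<Rightarrow> real" where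
  "g_one A = (if graver_basis A = {} then 0
              else Max ((\<lambda>g. norm1 (real_vec g)) ` graver_basis A))"

definition feasible ::
  "int ^ 'n ^ 'm \<Rightarrow> int ^ 'n \<Rightarrow> int ^ 'n \<Rightarrow> (int ^ 'n) set \<Rightarrow> (int ^ 'n) set" where
  "feasible A l u L = {x \<in> L. A *v x = 0 \<and> l \<le> x \<and> x \<le> u}"

definition optimal ::
  "(real ^ 'n \<Rightarrow> real) \<Rightarrow> (int ^ 'n) set \<Rightarrow> int ^ 'n \<Rightarrow> bool" where
  "optimal f S z \<longleftrightarrow> is_arg_min (\<lambda>x. f (real_vec x)) (\<lambda>x. x \<in> S) z"

end

theory Submission
  imports Defs
begin

text \<open>
  If \<open>z\<close> solves (1), \<open>z'\<close> solves (2) and some Graver element \<open>g\<close> satisfies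
  \<open>s g \<sqsubseteq> z - z'\<close>, then \<open>z - s g\<close> and \<open>z' + s g\<close> are feasible, and separable convexity gives
  \<open>f (z - s g) + f (z' + s g) \<le> f z + f z'\<close>, so both are again optimal, and closer together.
  Hence for a closest pair no such \<open>g\<close> exists. In that case \<open>z - z'\<close> is short: subtracting from
  a kernel vector the largest real multiple of a Graver element that stays conformal removes
  a coordinate from its support, so at most \<open>n\<close> multiples, each with factor less than \<open>s\<close>, exhaust it.
\<close>

section \<open>Finiteness of the Graver basis\<close>

text \<open>Call an index good if no later value is smaller. Every tail attains its minimum at a
  good index, so there are infinitely many good indices, and enumerating them gives the
  subsequence.\<close>

lemma nat_seq_incseq_subseq:
  fixes f :: "nat \<Rightarrow> nat"
  obtains r :: "nat \<Rightarrow> nat" where "strict_mono r" "incseq (f \<circ> r)"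
proof -
  define S where "S = {n. \<forall>m\<ge>n. f n \<le> f m}"
  have "\<exists>n\<ge>k. n \<in> S" for k
  proof -
    obtain n where n: "k \<le> n" "\<And>m. k \<le> m \<Longrightarrow> f n \<le> f m"
      using ex_has_least_nat[of "\<lambda>m. k \<le> m" k f] by auto
    then show ?thesis
      unfolding S_def by (intro exI[of _ n]) auto
  qed
  then have "infinite S"
    by (simp add: infinite_nat_iff_unbounded_le)
  then obtain r :: "nat \<Rightarrow> nat" where r: "strict_mono r" "\<And>n. r n \<in> S"
    using infinite_enumerate by blast
  have "incseq (f \<circ> r)"
    unfolding incseq_def
  proof (intro allI impI)
    fix m n :: nat assume "m \<le> n"
    then have "r m \<le> r n"
      using r(1) by (simp add: strict_mono_less_eq)
    then show "(f \<circ> r) m \<le> (f \<circ> r) n"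
      using r(2)[of m] by (simp add: S_def)
  qed
  with r(1) show thesis by (rule that)
qed

text \<open>Dickson's lemma in subsequence form. The coordinates are treated one at a time: passing
  to a further subsequence keeps the earlier coordinates nondecreasing.\<close>

lemma dickson_subseq:
  fixes f :: "nat \<Rightarrow> 'a \<Rightarrow> nat"
  assumes "finite I"
  shows "\<exists>r. strict_mono r \<and> (\<forall>i\<in>I. incseq (\<lambda>k. f (r k) i))"
  using assms
proof (induction I)
  case empty
  show ?case by (auto intro: exI[of _ id] simp: strict_mono_def)
next
  case (insert j I)
  then obtain r where r: "strict_mono r" "\<And>i. i \<in> I \<Longrightarrow> incseq (\<lambda>k. f (r k) i)"
    by blast
  obtain q where q: "strict_mono q" "incseq ((\<lambda>k. f (r k) j) \<circ> q)"
    by (rule nat_seq_incseq_subseq)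
  have "incseq (\<lambda>k. f (r (q k)) i)" if "i \<in> I" for i
    using r(2)[OF that] q(1) by (simp add: incseq_def strict_mono_less_eq)
  then show ?case
    using q r(1) strict_mono_o[OF r(1) q(1)] by (intro exI[of _ "r \<circ> q"]) (auto simp: comp_def)
qed

section \<open>The conformal order on integer vectors\<close>

lemma conformal_real_vec_iff:
  "real_vec x \<sqsubseteq>\<^sub>c real_vec y \<longleftrightarrow> (\<forall>i. 0 \<le> x $ i * y $ i \<and> \<bar>x $ i\<bar> \<le> \<bar>y $ i\<bar>)"
  unfolding conformal_def real_vec_def
  by (simp flip: of_int_mult of_int_abs)

lemma conformal_trans:
  assumes "real_vec x \<sqsubseteq>\<^sub>c real_vec y" "real_vec y \<sqsubseteq>\<^sub>c real_vec z"
  shows "real_vec x \<sqsubseteq>\<^sub>c real_vec z"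
  unfolding conformal_real_vec_iff
proof (intro allI)
  fix i
  have "0 \<le> x $ i * y $ i" "\<bar>x $ i\<bar> \<le> \<bar>y $ i\<bar>" "0 \<le> y $ i * z $ i" "\<bar>y $ i\<bar> \<le> \<bar>z $ i\<bar>"
    using assms by (auto simp: conformal_real_vec_iff)
  then show "0 \<le> x $ i * z $ i \<and> \<bar>x $ i\<bar> \<le> \<bar>z $ i\<bar>"
    by (smt (verit) zero_le_mult_iff)
qed

text \<open>Graver elements are pairwise incomparable, whereas Dickson's lemma finds two comparable
  members in any sequence of integer vectors; injectivity of the sequence makes them
  distinct.\<close>

lemma finite_graver_basis: "finite (graver_basis A)"
proof (rule ccontr)
  assume "infinite (graver_basis A)"
  then obtain G :: "nat \<Rightarrow> int ^ 'a" where G: "inj G" "range G \<subseteq> graver_basis A"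
    using infinite_countable_subset by blast
  \<comment> \<open>Positive and negative parts as separate coordinates make \<open>\<sqsubseteq>\<close> the componentwise order.\<close>
  define f where "f k = (\<lambda>(i, b). if b then nat (G k $ i) else nat (- (G k $ i)))" for k
  obtain r where r: "strict_mono r" "\<And>p. incseq (\<lambda>k. f (r k) p)"
    using dickson_subseq[of "UNIV :: ('a \<times> bool) set" f] by auto
  have "0 \<le> G (r 0) $ i * G (r 1) $ i \<and> \<bar>G (r 0) $ i\<bar> \<le> \<bar>G (r 1) $ i\<bar>" for i
  proof -
    have "nat (G (r 0) $ i) \<le> nat (G (r 1) $ i)" "nat (- (G (r 0) $ i)) \<le> nat (- (G (r 1) $ i))"
      using incseqD[OF r(2)[of "(i, True)"], of 0 1] incseqD[OF r(2)[of "(i, False)"], of 0 1]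
      by (auto simp: f_def)
    then show ?thesis
      by (auto simp: zero_le_mult_iff)
  qed
  then have "real_vec (G (r 0)) \<sqsubseteq>\<^sub>c real_vec (G (r 1))"
    by (simp add: conformal_real_vec_iff)
  moreover have "G (r 0) \<in> graver_basis A" "G (r 1) \<in> graver_basis A"
    using G(2) by auto
  ultimately have "G (r 0) = G (r 1)"
    by (auto simp: graver_basis_def Let_def)
  then have "r 0 = r 1"
    using G(1) by (simp add: inj_eq)
  then show False
    using strict_monoD[OF r(1), of 0 1] by simp
qed

lemma norm1_le_g_one: "g \<in> graver_basis A \<Longrightarrow> norm1 (real_vec g) \<le> g_one A"
  unfolding g_one_def using finite_graver_basis[of A] by auto

lemma infnorm_le_g_inf: "g \<in> graver_basis A \<Longrightarrow> infnorm (real_vec g) \<le> g_inf A"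
  unfolding g_inf_def using finite_graver_basis[of A] by auto

lemma g_one_nonneg: "0 \<le> g_one A"
proof (cases "graver_basis A = {}")
  case False
  then obtain g where "g \<in> graver_basis A" by blast
  then show ?thesis
    using norm1_le_g_one[of g A] by (smt (verit) norm1_def sum_nonneg)
qed (simp add: g_one_def)

lemma g_inf_nonneg: "0 \<le> g_inf A"
proof (cases "graver_basis A = {}")
  case False
  then obtain g where "g \<in> graver_basis A" by blast
  then show ?thesis
    using infnorm_le_g_inf[of g A] infnorm_pos_le[of "real_vec g"] by linarith
qed (simp add: g_inf_def)

section \<open>Kernel vectors without large conformal Graver multiples\<close>

lemma matrix_vector_mult_scale_int:
  fixes A :: "int ^ 'n ^ 'm"
  shows "A *v (c *s x) = c *s (A *v x)"
  by (simp add: vec_eq_iff matrix_vector_mult_def sum_distrib_left algebra_simps)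

lemma graver_basisD:
  assumes "g \<in> graver_basis A"
  shows "A *v g = 0" "g \<noteq> 0"
  using assms by (auto simp: graver_basis_def Let_def)

text \<open>Among the nonzero kernel vectors conformal to \<open>x\<close>, one of least 1-norm is
  minimal: whatever lies below it is conformal to \<open>x\<close> by transitivity, hence not
  shorter, hence equal to it.\<close>

lemma ex_conformal_graver:
  fixes A :: "int ^ 'n ^ 'm"
  assumes "A *v x = 0" "x \<noteq> 0"
  obtains g where "g \<in> graver_basis A" "real_vec g \<sqsubseteq>\<^sub>c real_vec x"
proof -
  let ?P = "\<lambda>h. A *v h = 0 \<and> h \<noteq> 0 \<and> real_vec h \<sqsubseteq>\<^sub>c real_vec x"
  let ?m = "\<lambda>h :: int ^ 'n. \<Sum>i\<in>UNIV. nat \<bar>h $ i\<bar>"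
  have "?P x"
    using assms by (simp add: conformal_real_vec_iff)
  then obtain g where g: "?P g" "\<And>h. ?P h \<Longrightarrow> ?m g \<le> ?m h"
    using ex_has_least_nat[of ?P x ?m] by blast
  have "h = g" if h: "A *v h = 0" "h \<noteq> 0" "real_vec h \<sqsubseteq>\<^sub>c real_vec g" for h
  proof -
    have le: "?m g \<le> ?m h"
      using g h conformal_trans by blast
    have c: "0 \<le> h $ i * g $ i" "\<bar>h $ i\<bar> \<le> \<bar>g $ i\<bar>" for i
      using h(3) by (auto simp: conformal_real_vec_iff)
    \<comment> \<open>No coordinate of \<open>h\<close> exceeds that of \<open>g\<close> in absolute
      value, so a single strict drop would make \<open>h\<close> shorter than
      \<open>g\<close>.\<close>
    have "nat \<bar>h $ i\<bar> = nat \<bar>g $ i\<bar>" for i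
    proof (rule ccontr)
      assume "nat \<bar>h $ i\<bar> \<noteq> nat \<bar>g $ i\<bar>"
      then have "nat \<bar>h $ i\<bar> < nat \<bar>g $ i\<bar>"
        using c(2)[of i] by linarith
      then have "?m h < ?m g"
        using c(2) by (intro sum_strict_mono_ex1) (auto simp: nat_mono)
      with le show False by simp
    qed
    then have "\<bar>h $ i\<bar> = \<bar>g $ i\<bar>" for i
      by (metis abs_ge_zero nat_0_le)
    then have "h $ i = g $ i" for i
      using c(1)[of i] by (smt (verit) zero_le_mult_iff)
    then show "h = g"
      by (simp add: vec_eq_iff)
  qed
  with g have "g \<in> graver_basis A"
    by (auto simp: graver_basis_def Let_def)
  with g show thesis
    by (intro that) auto
qed

lemma conformal_scale_iff:
  assumes "c > 0"
  shows "real_vec (c *s x) \<sqsubseteq>\<^sub>c real_vec (c *s y) \<longleftrightarrow> real_vec x \<sqsubseteq>\<^sub>c real_vec y"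
proof -
  have "c * x $ i * (c * y $ i) = c\<^sup>2 * (x $ i * y $ i)" for i
    by (simp add: power2_eq_square)
  then have "0 \<le> c * x $ i * (c * y $ i) \<longleftrightarrow> 0 \<le> x $ i * y $ i" for i
    using assms by (simp only: zero_le_mult_iff[of "c\<^sup>2"]) auto
  then show ?thesis
    using assms by (simp add: conformal_real_vec_iff abs_mult)
qed

text \<open>
  The step of the descent on the support, multiplied by \<open>\<bar>g $ i\<bar>\<close> to stay within the integers.
\<close>

lemma conformal_elimination:
  fixes x g :: "int ^ 'n"
  assumes "real_vec g \<sqsubseteq>\<^sub>c real_vec x" "g \<noteq> 0"
  obtains i where "g $ i \<noteq> 0" "\<And>j. \<bar>x $ i\<bar> * \<bar>g $ j\<bar> \<le> \<bar>g $ i\<bar> * \<bar>x $ j\<bar>"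
    "real_vec (\<bar>g $ i\<bar> *s x - \<bar>x $ i\<bar> *s g) \<sqsubseteq>\<^sub>c real_vec (\<bar>g $ i\<bar> *s x)"
    "(\<bar>g $ i\<bar> *s x - \<bar>x $ i\<bar> *s g) $ i = 0"
proof -
  \<comment> \<open>A real multiple of \<open>g\<close> with nonnegative factor is conformal to
    \<open>x\<close> iff the factor is at most every such ratio on the support of \<open>g\<close>;
    the least ratio is therefore the largest factor allowed, and coordinate \<open>i\<close> attains
    it.\<close>
  let ?q = "\<lambda>j. real_of_int \<bar>x $ j\<bar> / real_of_int \<bar>g $ j\<bar>"
  have S: "finite {j. g $ j \<noteq> 0}" "{j. g $ j \<noteq> 0} \<noteq> {}"
    using assms(2) by (auto simp: vec_eq_iff)
  obtain i where i: "g $ i \<noteq> 0" "\<And>j. g $ j \<noteq> 0 \<Longrightarrow> ?q i \<le> ?q j"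
    using ex_is_arg_min_if_finite[OF S, of ?q] unfolding is_arg_min_linorder by blast
  have c: "0 \<le> g $ j * x $ j" "\<bar>g $ j\<bar> \<le> \<bar>x $ j\<bar>" for j
    using assms(1) by (auto simp: conformal_real_vec_iff)
  have le: "\<bar>x $ i\<bar> * \<bar>g $ j\<bar> \<le> \<bar>g $ i\<bar> * \<bar>x $ j\<bar>" for j
  proof (cases "g $ j = 0")
    case False
    then have "real_of_int \<bar>x $ i\<bar> * real_of_int \<bar>g $ j\<bar> \<le> real_of_int \<bar>g $ i\<bar> * real_of_int \<bar>x $ j\<bar>"
      using i(2)[OF False] i(1) by (simp add: field_simps)
    then show ?thesis
      by (simp flip: of_int_mult of_int_abs)
  qed simp
  have "0 \<le> (\<bar>g $ i\<bar> * x $ j - \<bar>x $ i\<bar> * g $ j) * (\<bar>g $ i\<bar> * x $ j) \<and>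
        \<bar>\<bar>g $ i\<bar> * x $ j - \<bar>x $ i\<bar> * g $ j\<bar> \<le> \<bar>\<bar>g $ i\<bar> * x $ j\<bar>" for j
  proof -
    \<comment> \<open>With \<open>a * b\<close> nonnegative and \<open>b\<close> no larger than
      \<open>a\<close> in absolute value, \<open>a - b\<close> lies between 0 and
      \<open>a\<close>.\<close>
    define a b where "a = \<bar>g $ i\<bar> * x $ j" and "b = \<bar>x $ i\<bar> * g $ j"
    have "\<bar>b\<bar> \<le> \<bar>a\<bar>"
      using le[of j] by (simp add: a_def b_def abs_mult)
    moreover have "0 \<le> a * b"
    proof -
      have "a * b = (\<bar>g $ i\<bar> * \<bar>x $ i\<bar>) * (g $ j * x $ j)"
        by (simp add: a_def b_def)
      also have "\<dots> \<ge> 0"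
        using c(1)[of j] by (intro mult_nonneg_nonneg[OF mult_nonneg_nonneg]) simp_all
      finally show ?thesis .
    qed
    ultimately have "0 \<le> (a - b) * a \<and> \<bar>a - b\<bar> \<le> \<bar>a\<bar>"
      by (smt (verit) zero_le_mult_iff)
    then show ?thesis
      by (simp add: a_def b_def)
  qed
  then have "real_vec (\<bar>g $ i\<bar> *s x - \<bar>x $ i\<bar> *s g) \<sqsubseteq>\<^sub>c real_vec (\<bar>g $ i\<bar> *s x)"
    by (simp add: conformal_real_vec_iff)
  moreover have "(\<bar>g $ i\<bar> *s x - \<bar>x $ i\<bar> *s g) $ i = 0"
    using c(1)[of i] by (auto simp: abs_if zero_le_mult_iff)
  ultimately show thesis
    using i(1) le by (intro that)
qed

section \<open>Seminorm bound by descent on the support\<close>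

lemma real_vec_diff: "real_vec (x - y) = real_vec x - real_vec y"
  by (simp add: real_vec_def vec_eq_iff)

lemma real_vec_add: "real_vec (x + y) = real_vec x + real_vec y"
  by (simp add: real_vec_def vec_eq_iff)

text \<open>The abstract \<open>N\<close> serves both norms at once. Each round splits off a Graver
  element with factor at most \<open>t\<close>, costing at most \<open>t * C\<close>, and shrinks
  the support. Since the remainder is kept integral by multiplying with
  \<open>\<bar>g $ i\<bar>\<close>, the forbidden factor grows by the same amount, so
  \<open>t\<close> must vary in the induction.\<close>

lemma kernel_seminorm_bound:
  fixes A :: "int ^ 'n ^ 'm" and N :: "real ^ 'n \<Rightarrow> real"
  assumes triangle: "\<And>a b. N (a + b) \<le> N a + N b"
    and scale: "\<And>c a. N (c *\<^sub>R a) = \<bar>c\<bar> * N a"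
    and graver: "\<And>g. g \<in> graver_basis A \<Longrightarrow> N (real_vec g) \<le> C" and "0 \<le> C"
    and "A *v x = 0" "0 < t"
    and "\<And>g. g \<in> graver_basis A \<Longrightarrow> \<not> real_vec (t *s g) \<sqsubseteq>\<^sub>c real_vec x"
  shows "N (real_vec x) \<le> of_int t * real (card {i. x $ i \<noteq> 0}) * C"
  using assms(5-7)
proof (induction "card {i. x $ i \<noteq> 0}" arbitrary: x t rule: less_induct)
  case less
  show ?case
  proof (cases "x = 0")
    case True
    then have "real_vec x = 0 *\<^sub>R 0"
      by (simp add: real_vec_def vec_eq_iff)
    then show ?thesis
      using scale[of 0 0] True by simp
  next
    case False
    with less.prems(1) obtain g where g: "g \<in> graver_basis A" "real_vec g \<sqsubseteq>\<^sub>c real_vec x"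
      by (rule ex_conformal_graver)
    define y where "y i = \<bar>g $ i\<bar> *s x - \<bar>x $ i\<bar> *s g" for i
    obtain i where i: "g $ i \<noteq> 0" "\<And>j. \<bar>x $ i\<bar> * \<bar>g $ j\<bar> \<le> \<bar>g $ i\<bar> * \<bar>x $ j\<bar>"
      "real_vec (y i) \<sqsubseteq>\<^sub>c real_vec (\<bar>g $ i\<bar> *s x)" "y i $ i = 0"
      using conformal_elimination[OF g(2) graver_basisD(2)[OF g(1)]] unfolding y_def by metis
    define d where "d = \<bar>g $ i\<bar>"
    have d: "0 < d"
      using i(1) by (simp add: d_def)
    have c: "0 \<le> g $ j * x $ j" for j
      using g(2) by (auto simp: conformal_real_vec_iff)
    \<comment> \<open>The factor split off is \<open>\<bar>x $ i\<bar> / d\<close>, the least of the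
      ratios. Were it larger than \<open>t\<close>, all ratios would be, and \<open>t *s g\<close>
      would be conformal to \<open>x\<close>.\<close>
    have xi: "\<bar>x $ i\<bar> \<le> t * d"
    proof (rule ccontr)
      assume "\<not> \<bar>x $ i\<bar> \<le> t * d"
      have "\<bar>t * g $ j\<bar> \<le> \<bar>x $ j\<bar>" for j
      proof -
        have "d * (t * \<bar>g $ j\<bar>) \<le> \<bar>x $ i\<bar> * \<bar>g $ j\<bar>"
          using \<open>\<not> \<bar>x $ i\<bar> \<le> t * d\<close> mult_right_mono[of "t * d" "\<bar>x $ i\<bar>" "\<bar>g $ j\<bar>"]
          by (simp add: algebra_simps)
        also have "\<dots> \<le> d * \<bar>x $ j\<bar>"
          using i(2)[of j] by (simp add: d_def)
        finally show ?thesis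
          using d less.prems(2) by (simp add: abs_mult)
      qed
      moreover have "0 \<le> t * g $ j * x $ j" for j
        using c[of j] less.prems(2) by (simp add: mult.assoc)
      ultimately have "real_vec (t *s g) \<sqsubseteq>\<^sub>c real_vec x"
        by (simp add: conformal_real_vec_iff)
      with less.prems(3) g(1) show False by blast
    qed
    have "\<bar>y i $ j\<bar> \<le> \<bar>g $ i\<bar> * \<bar>x $ j\<bar>" for j
      using i(3) by (simp add: conformal_real_vec_iff abs_mult)
    then have "x $ j = 0 \<Longrightarrow> y i $ j = 0" for j
      by (metis abs_le_zero_iff abs_zero mult_zero_right)
    then have supp: "{j. y i $ j \<noteq> 0} \<subseteq> {j. x $ j \<noteq> 0} - {i}"
      using i(4) by auto
    \<comment> \<open>Thus \<open>i\<close> really leaves the support, and the cardinality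
      drops.\<close>
    have "x $ i \<noteq> 0"
      using g(2) i(1) unfolding conformal_real_vec_iff by (metis abs_le_zero_iff abs_zero)
    then have card_x: "card {j. x $ j \<noteq> 0} = Suc (card ({j. x $ j \<noteq> 0} - {i}))"
      by (subst card.remove[of _ i]) auto
    have card_y: "card {j. y i $ j \<noteq> 0} \<le> card ({j. x $ j \<noteq> 0} - {i})"
      using supp by (intro card_mono) auto
    have "A *v y i = 0"
      using less.prems(1) graver_basisD(1)[OF g(1)]
      by (simp add: y_def matrix_vector_mult_diff_distrib matrix_vector_mult_scale_int)
    \<comment> \<open>A multiple conformal to the remainder would be conformal to
      \<open>d *s x\<close>; cancelling \<open>d\<close> contradicts the assumption on
      \<open>x\<close>.\<close>
    moreover have "\<not> real_vec ((d * t) *s h) \<sqsubseteq>\<^sub>c real_vec (y i)" if "h \<in> graver_basis A" for h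
    proof
      assume "real_vec ((d * t) *s h) \<sqsubseteq>\<^sub>c real_vec (y i)"
      then have "real_vec ((d * t) *s h) \<sqsubseteq>\<^sub>c real_vec (d *s x)"
        using i(3) conformal_trans unfolding d_def by blast
      moreover have "(d * t) *s h = d *s (t *s h)"
        by (simp add: vec_eq_iff)
      ultimately show False
        using conformal_scale_iff[OF d] less.prems(3)[OF that] by metis
    qed
    ultimately have IH: "N (real_vec (y i)) \<le> of_int (d * t) * real (card {j. y i $ j \<noteq> 0}) * C"
      using d less.prems(2) card_x card_y by (intro less.hyps) auto
    have "of_int d *\<^sub>R real_vec x = real_vec (y i) + of_int \<bar>x $ i\<bar> *\<^sub>R real_vec g"
      by (simp add: y_def d_def real_vec_def vec_eq_iff)
    then have "of_int d * N (real_vec x) \<le> N (real_vec (y i)) + of_int \<bar>x $ i\<bar> * N (real_vec g)"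
      using triangle[of "real_vec (y i)" "of_int \<bar>x $ i\<bar> *\<^sub>R real_vec g"] d
        scale[of "of_int d" "real_vec x"] scale[of "of_int \<bar>x $ i\<bar>" "real_vec g"] by simp
    \<comment> \<open>The induction hypothesis pays for the support without \<open>i\<close>, the
      split-off multiple for \<open>i\<close> itself; together this is \<open>d\<close> times the
      claim.\<close>
    also have "\<dots> \<le> of_int (d * t) * real (card ({j. x $ j \<noteq> 0} - {i})) * C + of_int (t * d) * C"
    proof (rule add_mono)
      show "N (real_vec (y i)) \<le> of_int (d * t) * real (card ({j. x $ j \<noteq> 0} - {i})) * C"
        using IH card_y d less.prems(2) \<open>0 \<le> C\<close>
        by (elim order_trans) (intro mult_right_mono mult_left_mono; simp)
      have "of_int \<bar>x $ i\<bar> * N (real_vec g) \<le> of_int \<bar>x $ i\<bar> * C"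
        using graver[OF g(1)] by (intro mult_left_mono) auto
      also have "\<dots> \<le> of_int (t * d) * C"
        using xi \<open>0 \<le> C\<close> by (intro mult_right_mono) (simp_all only: of_int_le_iff)
      finally show "of_int \<bar>x $ i\<bar> * N (real_vec g) \<le> of_int (t * d) * C" .
    qed
    also have "\<dots> = of_int d * (of_int t * real (card {j. x $ j \<noteq> 0}) * C)"
      by (simp add: card_x algebra_simps)
    finally show ?thesis
      using d by simp
  qed
qed

lemma norm1_triangle: "norm1 (a + b) \<le> norm1 a + norm1 b"
  unfolding norm1_def sum.distrib[symmetric] by (intro sum_mono) (simp add: abs_triangle_ineq)

lemma norm1_scale: "norm1 (c *\<^sub>R a) = \<bar>c\<bar> * norm1 a"
  by (simp add: norm1_def abs_mult sum_distrib_left)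

text \<open>Both norms are instances of the seminorm bound, with the support size estimated by the
  dimension and \<open>t\<close> by \<open>t + 1\<close>.\<close>

lemma kernel_norm_bounds:
  fixes A :: "int ^ 'n ^ 'm"
  assumes "A *v x = 0" "0 < t"
    and "\<And>g. g \<in> graver_basis A \<Longrightarrow> \<not> real_vec (t *s g) \<sqsubseteq>\<^sub>c real_vec x"
  shows "norm1 (real_vec x) \<le> (of_int t + 1) * real CARD('n) * g_one A"
    and "infnorm (real_vec x) \<le> (of_int t + 1) * real CARD('n) * g_inf A"
proof -
  have c: "real (card {i. x $ i \<noteq> 0}) \<le> real CARD('n)"
    by (simp add: card_mono)
  have *: "of_int t * real (card {i. x $ i \<noteq> 0}) * C \<le> (of_int t + 1) * real CARD('n) * C"
    if "0 \<le> C" for C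
    using assms(2) that c by (intro mult_right_mono mult_mono) auto
  show "norm1 (real_vec x) \<le> (of_int t + 1) * real CARD('n) * g_one A"
    using kernel_seminorm_bound[of norm1 A "g_one A" x t] *[OF g_one_nonneg[of A]] assms
      norm1_triangle norm1_scale norm1_le_g_one g_one_nonneg
    by (meson order_trans)
  show "infnorm (real_vec x) \<le> (of_int t + 1) * real CARD('n) * g_inf A"
    using kernel_seminorm_bound[of infnorm A "g_inf A" x t] *[OF g_inf_nonneg[of A]] assms
      infnorm_triangle infnorm_mul infnorm_le_g_inf g_inf_nonneg
    by (meson order_trans)
qed

section \<open>Exchange between optimal solutions\<close>

text \<open>The points \<open>a + d\<close> and \<open>b - d\<close> are convex combinations of
  \<open>a\<close> and \<open>b\<close> with swapped weights, so adding the two convexity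
  inequalities gives each value total weight 1.\<close>

lemma convex_on_exchange:
  fixes F :: "real \<Rightarrow> real"
  assumes "convex_on UNIV F" "0 \<le> d * (b - a)" "\<bar>d\<bar> \<le> \<bar>b - a\<bar>"
  shows "F (a + d) + F (b - d) \<le> F a + F b"
proof (cases "b = a")
  case True
  with assms(3) show ?thesis by simp
next
  case False
  define t where "t = d / (b - a)"
  have t: "0 \<le> t" "t \<le> 1"
    using assms(2,3) False by (auto simp: t_def zero_le_divide_iff zero_le_mult_iff divide_le_eq_1)
  have d: "d = t * (b - a)"
    using False by (simp add: t_def)
  have "F ((1 - t) *\<^sub>R a + t *\<^sub>R b) \<le> (1 - t) * F a + t * F b"
    using convex_onD[OF assms(1) t] by simp
  moreover have "F ((1 - t) *\<^sub>R b + t *\<^sub>R a) \<le> (1 - t) * F b + t * F a"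
    using convex_onD[OF assms(1) t] by simp
  moreover have "(1 - t) *\<^sub>R a + t *\<^sub>R b = a + d" "(1 - t) *\<^sub>R b + t *\<^sub>R a = b - d"
    by (simp_all add: d algebra_simps)
  ultimately show ?thesis
    by (simp add: algebra_simps)
qed

lemma separable_convex_exchange:
  assumes "separable_convex f" "real_vec w \<sqsubseteq>\<^sub>c real_vec (z - y)"
  shows "f (real_vec (y + w)) + f (real_vec (z - w)) \<le> f (real_vec y) + f (real_vec z)"
proof -
  obtain F where F: "\<And>i. convex_on UNIV (F i)" "\<And>x. f x = (\<Sum>i\<in>UNIV. F i (x $ i))"
    using assms(1) unfolding separable_convex_def by auto
  have "F i (real_vec y $ i + real_vec w $ i) + F i (real_vec z $ i - real_vec w $ i)
      \<le> F i (real_vec y $ i) + F i (real_vec z $ i)" for i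
    using assms(2) by (intro convex_on_exchange[OF F(1)]) (auto simp: conformal_def real_vec_diff)
  then show ?thesis
    unfolding F(2) sum.distrib[symmetric] by (intro sum_mono) (simp add: real_vec_add real_vec_diff)
qed

lemma conformal_between:
  fixes w y z :: "int ^ 'n"
  assumes "real_vec w \<sqsubseteq>\<^sub>c real_vec (z - y)" "l \<le> y" "l \<le> z" "y \<le> u" "z \<le> u"
  shows "l \<le> y + w" "y + w \<le> u" "l \<le> z - w" "z - w \<le> u"
proof -
  have "l $ i \<le> y $ i + w $ i \<and> y $ i + w $ i \<le> u $ i \<and> l $ i \<le> z $ i - w $ i \<and> z $ i - w $ i \<le> u $ i"
    for i
  proof -
    have "0 \<le> w $ i * (z $ i - y $ i)" "\<bar>w $ i\<bar> \<le> \<bar>z $ i - y $ i\<bar>"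
      using assms(1) by (auto simp: conformal_real_vec_iff)
    moreover have "l $ i \<le> y $ i" "l $ i \<le> z $ i" "y $ i \<le> u $ i" "z $ i \<le> u $ i"
      using assms(2-5) by (auto simp: less_eq_vec_def)
    ultimately show ?thesis
      by (smt (verit) zero_le_mult_iff)
  qed
  then show "l \<le> y + w" "y + w \<le> u" "l \<le> z - w" "z - w \<le> u"
    by (auto simp: less_eq_vec_def)
qed

lemma optimal_iff: "optimal f S z \<longleftrightarrow> z \<in> S \<and> (\<forall>x\<in>S. f (real_vec z) \<le> f (real_vec x))"
  by (auto simp: optimal_def is_arg_min_def not_less)

text \<open>The step \<open>s *s g\<close> preserves both the kernel and the scaled lattice, and
  conformality keeps both points in the box.\<close>

lemma optimal_exchange:
  fixes A :: "int ^ 'n ^ 'm"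
  assumes f: "separable_convex f"
    and z: "optimal f (feasible A l u UNIV) z"
    and y: "optimal f (feasible A l u (scaled_lattice s)) y"
    and g: "A *v g = 0" "real_vec (s *s g) \<sqsubseteq>\<^sub>c real_vec (z - y)"
  shows "optimal f (feasible A l u UNIV) (z - s *s g)"
    and "optimal f (feasible A l u (scaled_lattice s)) (y + s *s g)"
proof -
  have feas: "A *v z = 0" "l \<le> z" "z \<le> u" "A *v y = 0" "l \<le> y" "y \<le> u" "y \<in> scaled_lattice s"
    using z y by (auto simp: optimal_iff feasible_def)
  then obtain v where "y = s *s v"
    by (auto simp: scaled_lattice_def)
  then have "y + s *s g = s *s (v + g)"
    by (simp add: vec_eq_iff algebra_simps)
  then have "y + s *s g \<in> scaled_lattice s"
    unfolding scaled_lattice_def by (rule range_eqI)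
  then have y': "y + s *s g \<in> feasible A l u (scaled_lattice s)"
    using feas g(1) conformal_between[OF g(2)]
    by (simp add: feasible_def matrix_vector_right_distrib matrix_vector_mult_scale_int)
  have z': "z - s *s g \<in> feasible A l u UNIV"
    using feas g(1) conformal_between[OF g(2)]
    by (simp add: feasible_def matrix_vector_mult_diff_distrib matrix_vector_mult_scale_int)
  have "f (real_vec (y + s *s g)) + f (real_vec (z - s *s g)) \<le> f (real_vec y) + f (real_vec z)"
    by (rule separable_convex_exchange[OF f g(2)])
  \<comment> \<open>By optimality neither value can drop, and their sum does not rise, so both stay
    the same.\<close>
  moreover have "f (real_vec y) \<le> f (real_vec (y + s *s g))" "f (real_vec z) \<le> f (real_vec (z - s *s g))"
    using z y z' y' by (auto simp: optimal_iff)
  ultimately have "f (real_vec (y + s *s g)) = f (real_vec y)" "f (real_vec (z - s *s g)) = f (real_vec z)"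
    by auto
  then show "optimal f (feasible A l u UNIV) (z - s *s g)"
    "optimal f (feasible A l u (scaled_lattice s)) (y + s *s g)"
    using z y z' y' by (auto simp: optimal_iff)
qed

section \<open>Existence of optima and decrease of the distance\<close>

lemma finite_int_vec_interval: "finite {x :: int ^ 'n. l \<le> x \<and> x \<le> u}"
proof -
  have "{x :: int ^ 'n. l \<le> x \<and> x \<le> u} \<subseteq> vec_lambda ` (\<Pi>\<^sub>E i\<in>UNIV. {l $ i..u $ i})"
  proof
    fix x :: "int ^ 'n" assume "x \<in> {x. l \<le> x \<and> x \<le> u}"
    then have "vec_nth x \<in> (\<Pi>\<^sub>E i\<in>UNIV. {l $ i..u $ i})"
      by (auto simp: less_eq_vec_def)
    then have "vec_lambda (vec_nth x) \<in> vec_lambda ` (\<Pi>\<^sub>E i\<in>UNIV. {l $ i..u $ i})"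
      by (rule imageI)
    then show "x \<in> vec_lambda ` (\<Pi>\<^sub>E i\<in>UNIV. {l $ i..u $ i})"
      by simp
  qed
  then show ?thesis
    by (rule finite_subset) (intro finite_imageI finite_PiE; simp)
qed

lemma ex_optimal:
  assumes "l \<le> 0" "0 \<le> u" "0 \<in> L"
  shows "\<exists>x. optimal f (feasible A l u L) x"
proof -
  have "finite (feasible A l u L)"
    by (rule finite_subset[OF _ finite_int_vec_interval[of l u]]) (auto simp: feasible_def)
  moreover have "feasible A l u L \<noteq> {}"
    using assms by (auto simp: feasible_def)
  ultimately show ?thesis
    unfolding optimal_def using ex_is_arg_min_if_finite by blast
qed

text \<open>Subtracting a conformal vector lowers each absolute value by exactly that of the
  subtracted entry. This makes an exchange shorten the distance.\<close>

lemma sum_abs_diff_less: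
  fixes x w :: "int ^ 'n"
  assumes "real_vec w \<sqsubseteq>\<^sub>c real_vec x" "w \<noteq> 0"
  shows "(\<Sum>i\<in>UNIV. nat \<bar>(x - w) $ i\<bar>) < (\<Sum>i\<in>UNIV. nat \<bar>x $ i\<bar>)"
proof (rule sum_strict_mono_ex1)
  have c: "0 \<le> w $ i * x $ i" "\<bar>w $ i\<bar> \<le> \<bar>x $ i\<bar>" for i
    using assms(1) by (auto simp: conformal_real_vec_iff)
  have *: "\<bar>x $ i - w $ i\<bar> = \<bar>x $ i\<bar> - \<bar>w $ i\<bar>" for i
    using c[of i] by (smt (verit) zero_le_mult_iff)
  show "\<forall>i\<in>UNIV. nat \<bar>(x - w) $ i\<bar> \<le> nat \<bar>x $ i\<bar>"
    by (simp add: * nat_mono)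
  obtain i where "w $ i \<noteq> 0"
    using assms(2) by (auto simp: vec_eq_iff)
  then show "\<exists>i\<in>UNIV. nat \<bar>(x - w) $ i\<bar> < nat \<bar>x $ i\<bar>"
    using c(2)[of i] by (intro bexI[of _ i]) (auto simp: *)
qed simp

theorem theorem64:
  fixes A :: "int ^ 'n ^ 'm"
    and l u :: "int ^ 'n"
    and f :: "real ^ 'n \<Rightarrow> real"
    and s :: int
  assumes "l \<le> 0" and "0 \<le> u"
    and "separable_convex f"
    and "s \<ge> 1"
  shows
    "(\<forall>z. optimal f (feasible A l u UNIV) z \<longrightarrow>
        (\<exists>zs. optimal f (feasible A l u (scaled_lattice s)) zs \<and>
           norm1 (real_vec z - real_vec zs) \<le> (of_int s + 1) * real CARD('n) * g_one A \<and>
           infnorm (real_vec z - real_vec zs) \<le> (of_int s + 1) * real CARD('n) * g_inf A)) \<and>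
     (\<forall>zs. optimal f (feasible A l u (scaled_lattice s)) zs \<longrightarrow>
        (\<exists>z. optimal f (feasible A l u UNIV) z \<and>
           norm1 (real_vec z - real_vec zs) \<le> (of_int s + 1) * real CARD('n) * g_one A \<and>
           infnorm (real_vec z - real_vec zs) \<le> (of_int s + 1) * real CARD('n) * g_inf A))"
proof -
  let ?O1 = "optimal f (feasible A l u UNIV)"
  let ?O2 = "optimal f (feasible A l u (scaled_lattice s))"
  \<comment> \<open>The 1-norm distance as a natural number, so that a closest partner
    exists.\<close>
  let ?dist = "\<lambda>z y :: int ^ 'n. \<Sum>i\<in>UNIV. nat \<bar>(z - y) $ i\<bar>"
  let ?bounds = "\<lambda>z zs. norm1 (real_vec z - real_vec zs) \<le> (of_int s + 1) * real CARD('n) * g_one A \<and>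
    infnorm (real_vec z - real_vec zs) \<le> (of_int s + 1) * real CARD('n) * g_inf A"
  \<comment> \<open>Being closest with one end held fixed is enough, because moving either end alone
    by \<open>s *s g\<close> already shortens the distance. Both bounds come from the same absence
    of conformal multiples, hence hold for the same pair.\<close>
  have bounds: "?bounds z y"
    if z: "?O1 z" and y: "?O2 y"
      and closest: "(\<forall>y'. ?O2 y' \<longrightarrow> ?dist z y \<le> ?dist z y') \<or> (\<forall>z'. ?O1 z' \<longrightarrow> ?dist z y \<le> ?dist z' y)"
    for z y
  proof -
    have "\<not> real_vec (s *s g) \<sqsubseteq>\<^sub>c real_vec (z - y)" if g: "g \<in> graver_basis A" for g
    proof
      assume c: "real_vec (s *s g) \<sqsubseteq>\<^sub>c real_vec (z - y)"
      have "s *s g \<noteq> 0"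
        using graver_basisD(2)[OF g] assms(4) by (auto simp: vec_eq_iff)
      then have "?dist (z - s *s g) y < ?dist z y" "?dist z (y + s *s g) < ?dist z y"
        using sum_abs_diff_less[OF c] by (simp_all add: algebra_simps)
      with closest optimal_exchange[OF assms(3) z y graver_basisD(1)[OF g] c] show False
        by (meson not_less)
    qed
    moreover have "A *v (z - y) = 0"
      using z y by (simp add: optimal_iff feasible_def matrix_vector_mult_diff_distrib)
    ultimately show ?thesis
      using kernel_norm_bounds[of A "z - y" s] assms(4) by (simp add: real_vec_diff)
  qed
  \<comment> \<open>Zero is feasible for both problems, so both have optimal solutions among which a
    closest partner can be chosen.\<close>
  have "0 \<in> scaled_lattice s"
    by (auto simp: scaled_lattice_def image_iff vec_eq_iff intro: exI[of _ 0])
  then obtain y0 z0 where "?O2 y0" "?O1 z0"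
    using ex_optimal[OF assms(1,2)] by (metis UNIV_I)
  show ?thesis
  proof (intro conjI allI impI)
    fix z assume z: "?O1 z"
    obtain y where "?O2 y" "\<And>y'. ?O2 y' \<Longrightarrow> ?dist z y \<le> ?dist z y'"
      using ex_has_least_nat[of ?O2 y0 "?dist z"] \<open>?O2 y0\<close> by blast
    with z show "\<exists>y. ?O2 y \<and> ?bounds z y"
      using bounds by blast
  next
    fix y assume y: "?O2 y"
    obtain z where "?O1 z" "\<And>z'. ?O1 z' \<Longrightarrow> ?dist z y \<le> ?dist z' y"
      using ex_has_least_nat[of ?O1 z0 "\<lambda>z. ?dist z y"] \<open>?O1 z0\<close> by blast
    with y show "\<exists>z. ?O1 z \<and> ?bounds z y"
      using bounds by blast
  qed
qed

end
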